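(* Let $m,n$ be positive integers with $m\ge 4$ and $n\ge \frac{m(m-1)}{2}$. Assume that either $m$ is odd and $n\equiv 1 \pmod{m-2}$, or $m$ is even and $n\equiv \frac{m}{2}\pmod{m-2}$. Let \[c(n,m)=\frac{(m-3)n+m(m-1)/2}{m-2}\] (which is a positive integer under these hypotheses). Then every exact $c(n,m)$-coloring of $[1,n]$ admits a rainbow solution to $E_m$ in $[1,n]$.
   Context: For $m\ge 3$, $E_m$ denotes the equation $x_1+x_2+\cdots+x_{m-1}=x_m$. For a positive integer $n$, $[1,n]=\{1,2,\ldots,n\}$. An $r$-coloring of a set $S$ is a map $S\to\{1,\ldots,r\}$; it is exact if it is surjective. A solution to $E_m$ in $[1,n]$ is a tuple $(x_1,\ldots,x_m)$ of elements of $[1,n]$ satisfying $E_m$; under a coloring it is rainbow if the $m$ elements $x_1,\ldots,x_m$ receive pairwise distinct colors. *)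

theory Defs
  imports Complex_Main "HOL-Library.FuncSet" "HOL-Number_Theory.Cong"
begin

text \<open>Values of a coloring outside the colored set \<open>S\<close> are irrelevant.\<close>

definition coloring :: "nat \<Rightarrow> 'a set \<Rightarrow> ('a \<Rightarrow> nat) \<Rightarrow> bool" where
  "coloring r S \<chi> \<longleftrightarrow> \<chi> \<in> S \<rightarrow> {1..r}"

definition exact_coloring :: "nat \<Rightarrow> 'a set \<Rightarrow> ('a \<Rightarrow> nat) \<Rightarrow> bool" where
  "exact_coloring r S \<chi> \<longleftrightarrow> coloring r S \<chi> \<and> \<chi> ` S = {1..r}"

text \<open>A tuple \<open>(x\<^sub>1, \<dots>, x\<^sub>m)\<close> is a function \<open>x\<close> used only at the indices \<open>1, \<dots>, m\<close>;
  its entries need not be distinct.\<close>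

definition solution :: "nat \<Rightarrow> nat \<Rightarrow> (nat \<Rightarrow> nat) \<Rightarrow> bool" where
  "solution m n x \<longleftrightarrow> (\<forall>i\<in>{1..m}. x i \<in> {1..n}) \<and> (\<Sum>i=1..m - 1. x i) = x m"

definition rainbow :: "('a \<Rightarrow> nat) \<Rightarrow> nat \<Rightarrow> (nat \<Rightarrow> 'a) \<Rightarrow> bool" where
  "rainbow \<chi> m x \<longleftrightarrow> (\<forall>i\<in>{1..m}. \<forall>j\<in>{1..m}. i \<noteq> j \<longrightarrow> \<chi> (x i) \<noteq> \<chi> (x j))"

text \<open>Rational-valued, with exact division, so that integrality is a genuine claim.\<close>

definition c :: "nat \<Rightarrow> nat \<Rightarrow> rat" where
  "c n m = ((of_nat m - 3) * of_nat n + of_nat m * (of_nat m - 1) / 2) / (of_nat m - 2)"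

end

theory Submission
  imports Defs
begin

text \<open>
  Put \<open>d = m - 2\<close>; the hypotheses say \<open>n = 1 + d q + d (d - 1) / 2\<close> with \<open>q \<ge> 2\<close>, and then
  \<open>c n m = n - q + 2\<close>. Choose a set \<open>S\<close> of representatives of the colors with \<open>1 \<in> S\<close>, and let
  \<open>T = S - {1}\<close> and \<open>x = Max T\<close>. Only few numbers strictly between \<open>1\<close> and \<open>x\<close> are missing from \<open>T\<close>,
  so few that \<open>x - 1\<close> is at least the sum of the \<open>d\<close> smallest numbers that remain in the worst case,
  where the missing numbers are consecutive from \<open>2\<close> on. This lower bound already ensures that some
  \<open>d\<close> distinct elements of \<open>T\<close> sum to exactly \<open>x - 1\<close>: take the smallest available numbers
  greedily, and find the last two by pigeonhole among the pairs \<open>{y, N - y}\<close>.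
\<close>

lemma pair_sum_avoiding:
  fixes a N :: nat and B :: "nat set"
  assumes "finite B" "2 * (a + card B) + 3 \<le> N"
  obtains y z where "a < y" "y < z" "y \<notin> B" "z \<notin> B" "y + z = N"
proof -
  let ?Y = "{a<..a + card B + 1}"
  \<comment> \<open>\<open>f y\<close> lies in \<open>B\<close> as soon as one of \<open>y\<close>,
    \<open>N - y\<close> does, so a value outside \<open>B\<close> yields a pair avoiding
    \<open>B\<close>. The bound on \<open>N\<close> puts every \<open>y\<close> below every
    \<open>N - y'\<close>, hence injectivity.\<close>
  define f where "f y = (if y \<in> B then y else N - y)" for y
  have "inj_on f ?Y"
    using assms(2) by (auto simp: inj_on_def f_def split: if_splits)
  then have "card (f ` ?Y) = card B + 1"
    by (simp add: card_image)
  then have "\<not> f ` ?Y \<subseteq> B"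
    using card_mono[OF assms(1), of "f ` ?Y"] by auto
  then obtain y where "y \<in> ?Y" "f y \<notin> B"
    by blast
  with assms(2) that[of y "N - y"] show thesis
    by (auto simp: f_def split: if_splits)
qed

text \<open>The threshold is twice the sum of \<open>a + card B + 1\<close>, ...,
  \<open>a + card B + d\<close>, the least sum available when \<open>B\<close> fills the places
  right after \<open>a\<close>. The induction raises \<open>a\<close> by one, discarding
  \<open>a + 1\<close> if it is in \<open>B\<close> and taking it as a summand otherwise, until
  \<open>d = 2\<close>.\<close>

lemma distinct_sum_avoiding:
  fixes a d N :: nat and B :: "nat set"
  assumes "d \<ge> 2" "finite B" "B \<subseteq> {a<..}" "d * (2 * (a + card B) + d + 1) \<le> 2 * N"
  shows "\<exists>A \<subseteq> {a<..} - B. finite A \<and> card A = d \<and> \<Sum>A = N"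
  using assms
proof (induction "d + card B" arbitrary: d a B N)
  case 0
  then show ?case by simp
next
  case (Suc k)
  show ?case
  proof (cases "a + 1 \<in> B")
    case True
    let ?B = "B - {a + 1}"
    \<comment> \<open>Raising \<open>a\<close> while removing \<open>a + 1\<close> from
      \<open>B\<close> keeps \<open>a + card B\<close>, and so the threshold, unchanged.\<close>
    from True Suc.prems(2) have card: "card B = card ?B + 1"
      using card_Suc_Diff1[of B "a + 1"] by simp
    have "?B \<subseteq> {a + 1<..}"
      using Suc.prems(3) by fastforce
    then have "\<exists>A \<subseteq> {a + 1<..} - ?B. finite A \<and> card A = d \<and> \<Sum>A = N"
      using Suc.hyps(2) Suc.prems card by (intro Suc.hyps(1)) auto
    then obtain A where A: "A \<subseteq> {a + 1<..} - ?B" "finite A" "card A = d" "\<Sum>A = N"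
      by blast
    from A(1) have "A \<subseteq> {a<..} - B"
      by fastforce
    with A show ?thesis by blast
  next
    case False
    show ?thesis
    proof (cases "d = 2")
      case True
      then have "2 * (a + card B) + 3 \<le> N"
        using Suc.prems(4) by simp
      then obtain y z where "a < y" "y < z" "y \<notin> B" "z \<notin> B" "y + z = N"
        by (rule pair_sum_avoiding[OF Suc.prems(2)])
      then show ?thesis
        using True by (intro exI[of _ "{y, z}"]) auto
    next
      case neq: False
      then obtain e where e: "d = Suc e" "e \<ge> 2"
        using Suc.prems(1) by (cases d) auto
      \<comment> \<open>The old threshold exceeds the left-hand side by exactly
        \<open>2 * card B\<close>.\<close>
      have *: "e * (2 * (a + 1 + card B) + e + 1) + 2 * (a + 1) \<le> 2 * N"
        using Suc.prems(4) e by (simp add: algebra_simps)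
      then have "a + 1 \<le> N"
        by simp
      have "B \<subseteq> {a + 1<..}"
        using Suc.prems(3) False by (auto simp: subset_iff) (metis Suc_lessI)
      moreover have "e * (2 * (a + 1 + card B) + e + 1) \<le> 2 * (N - (a + 1))"
        using * by simp
      ultimately have "\<exists>A \<subseteq> {a + 1<..} - B. finite A \<and> card A = e \<and> \<Sum>A = N - (a + 1)"
        using Suc.hyps(2) Suc.prems(2) e by (intro Suc.hyps(1)) auto
      then obtain A where A: "A \<subseteq> {a + 1<..} - B" "finite A" "card A = e" "\<Sum>A = N - (a + 1)"
        by blast
      from A(1) have "a + 1 \<notin> A" "insert (a + 1) A \<subseteq> {a<..} - B"
        using False by fastforce+
      with A e \<open>a + 1 \<le> N\<close> show ?thesis
        by (intro exI[of _ "insert (a + 1) A"]) auto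
    qed
  qed
qed

lemma exact_coloring_transversal:
  assumes "exact_coloring r S \<chi>" "s \<in> S"
  obtains R where "R \<subseteq> S" "s \<in> R" "card R = r" "inj_on \<chi> R"
proof -
  \<comment> \<open>A right inverse of \<open>\<chi>\<close> on the colors, overridden at the color
    of \<open>s\<close> so that \<open>s\<close> represents it.\<close>
  define f where "f k = (if k = \<chi> s then s else inv_into S \<chi> k)" for k
  have img: "\<chi> ` S = {1..r}"
    using assms(1) by (simp add: exact_coloring_def)
  have f: "f k \<in> S \<and> \<chi> (f k) = k" if "k \<in> {1..r}" for k
    using that assms(2) inv_into_into[of k \<chi> S] f_inv_into_f[of k \<chi> S]
    by (auto simp: f_def img)
  have "inj_on f {1..r}"
    by (rule inj_on_inverseI[of _ \<chi>]) (use f in blast)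
  then have "card (f ` {1..r}) = r"
    by (simp add: card_image)
  moreover have "f ` {1..r} \<subseteq> S"
    using f by blast
  moreover have "inj_on \<chi> (f ` {1..r})"
    by (rule inj_on_inverseI[of _ f]) (use f in auto)
  moreover have "s \<in> f ` {1..r}"
  proof
    show "s = f (\<chi> s)" by (simp add: f_def)
    show "\<chi> s \<in> {1..r}" using assms(2) img by blast
  qed
  ultimately show thesis
    using that by blast
qed

text \<open>Passes from sets to tuples: enumerate \<open>A\<close> and append its sum. As the sum
  lies outside \<open>A\<close>, the entries are distinct, and \<open>\<chi>\<close> separates
  them.\<close>

lemma rainbow_solution_of_set:
  assumes "finite A" "A \<subseteq> {1..n}" "card A = k" "\<Sum>A \<in> {1..n} - A"
    and inj: "inj_on \<chi> (insert (\<Sum>A) A)"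
  shows "\<exists>x. solution (Suc k) n x \<and> rainbow \<chi> (Suc k) x"
proof -
  obtain h where h: "bij_betw h {1..k} A"
    using ex_bij_betw_nat_finite_1[OF assms(1)] assms(3) by auto
  let ?x = "\<lambda>i. if i = Suc k then \<Sum>A else h i"
  have hA: "h i \<in> A" if "1 \<le> i" "i \<le> k" for i
    using that bij_betwE[OF h] by auto
  have "(\<Sum>i=1..k. ?x i) = (\<Sum>i=1..k. h i)"
    by (rule sum.cong) auto
  also have "\<dots> = \<Sum>A"
    using sum.reindex_bij_betw[OF h, of "\<lambda>y. y"] by simp
  finally have "solution (Suc k) n ?x"
    using hA assms(2,4) by (fastforce simp: solution_def)
  moreover have "inj_on ?x {1..Suc k}"
  proof (rule inj_onI)
    fix i j assume "i \<in> {1..Suc k}" "j \<in> {1..Suc k}" "?x i = ?x j"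
    then show "i = j"
      using hA[of i] hA[of j] assms(4) inj_onD[OF bij_betw_imp_inj_on[OF h], of i j]
      by (auto simp: le_Suc_eq split: if_splits)
  qed
  then have "inj_on (\<chi> \<circ> ?x) {1..Suc k}"
    by (rule comp_inj_on) (rule inj_on_subset[OF inj], use hA in \<open>auto simp: le_Suc_eq\<close>)
  then have "rainbow \<chi> (Suc k) ?x"
    unfolding rainbow_def inj_on_def comp_def by blast
  ultimately show ?thesis by blast
qed

lemma rainbow_solution_exists:
  fixes d q n :: nat
  assumes d: "d \<ge> 2" and q: "q \<ge> 2" and n: "2 * n = 2 + 2 * d * q + d * (d - 1)"
    and \<chi>: "exact_coloring (n - q + 2) {1..n} \<chi>"
  shows "\<exists>x. solution (d + 2) n x \<and> rainbow \<chi> (d + 2) x"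
proof -
  have "2 * q \<le> d * q"
    using d by simp
  with n have "q < n"
    by linarith
  then have "1 \<in> {1..n}"
    by simp
  then obtain S where S: "S \<subseteq> {1..n}" "1 \<in> S" "card S = n - q + 2" "inj_on \<chi> S"
    using exact_coloring_transversal[OF \<chi>] by metis
  have fin: "finite S"
    using S(1) finite_subset by blast
  define T where "T = S - {1}"
  have T: "finite T" "T \<subseteq> {2..n}" "card T = n - q + 1"
    using S fin by (auto simp: T_def subset_iff Suc_le_eq le_less)
  then have "T \<noteq> {}"
    by auto
  define x where "x = Max T"
  have x: "x \<in> T" "T \<subseteq> {2..x}"
    using T \<open>T \<noteq> {}\<close> by (auto simp: x_def)
  define B where "B = {2..x} - T"
  have cardB: "card B = x - 1 - (n - q + 1)"
    using card_Diff_subset[OF T(1) x(2)] T(3) by (simp add: B_def)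
  have xn: "x \<le> n" "2 \<le> x"
    using x T by auto
  have "card T \<le> x - 1"
    using card_mono[OF _ x(2)] by simp
  \<comment> \<open>Of the numbers in \<open>{2..n}\<close>, \<open>T\<close> misses
    \<open>q - 2\<close>: those in \<open>B\<close> and the \<open>n - x\<close> above
    \<open>x\<close>.\<close>
  with T(3) \<open>q < n\<close> xn cardB have g: "card B + (n - x) + 2 = q"
    by linarith
  \<comment> \<open>Equality holds for \<open>x = n\<close>. With \<open>q\<close> fixed, lowering
    \<open>x\<close> by one lowers \<open>card B\<close> by one, so the left side drops by
    \<open>2 * d\<close> and the right only by \<open>2\<close>.\<close>
  have "d * (2 * (1 + card B) + d + 1) \<le> 2 * (x - 1)"
  proof -
    obtain e where e: "d = Suc e"
      using d by (cases d) auto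
    obtain h where h: "n = x + h"
      using xn(1) le_Suc_ex by blast
    have "q = card B + h + 2"
      using g h by simp
    then show ?thesis
      using n unfolding e h by (simp add: algebra_simps)
  qed
  then obtain A where A: "A \<subseteq> {1<..} - B" "finite A" "card A = d" "\<Sum>A = x - 1"
    using distinct_sum_avoiding[OF d, of B 1 "x - 1"] by (force simp: B_def)
  \<comment> \<open>Members of \<open>A\<close> are at most their sum \<open>x - 1\<close>; numbers
    in \<open>{2..x}\<close> outside \<open>B\<close> are in \<open>T\<close>.\<close>
  have AT: "A \<subseteq> T - {x}"
  proof
    fix y assume "y \<in> A"
    moreover from this have "y \<le> x - 1"
      using member_le_sum[of y A "\<lambda>y. y"] A by simp
    ultimately show "y \<in> T - {x}"
      using A(1) xn by (auto simp: B_def subset_iff)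
  qed
  have "1 \<notin> A"
    using A(1) by auto
  then have sum: "\<Sum>(insert 1 A) = x" and card: "card (insert 1 A) = d + 1"
    using A xn by simp_all
  have sub: "insert x (insert 1 A) \<subseteq> S"
    using AT x S(2) by (auto simp: T_def)
  then have "inj_on \<chi> (insert x (insert 1 A))"
    by (rule inj_on_subset[OF S(4)])
  moreover have "insert 1 A \<subseteq> {1..n}"
    using sub S(1) by (meson insert_subset subset_trans)
  moreover have "x \<in> {1..n} - insert 1 A"
    using AT xn by auto
  ultimately show ?thesis
    using rainbow_solution_of_set[of "insert 1 A" n "d + 1" \<chi>] A(2) unfolding sum card by simp
qed

text \<open>Both parity cases say \<open>n\<close> is congruent to
  \<open>1 + d * (d - 1) div 2\<close> modulo \<open>d\<close>; the equation is doubled to avoid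
  division.\<close>

lemma parameter_decomposition:
  fixes m n :: nat
  assumes m: "m \<ge> 4"
    and n: "n \<ge> m * (m - 1) div 2"
    and cong: "(odd m \<and> [n = 1] (mod (m - 2))) \<or> (even m \<and> [n = m div 2] (mod (m - 2)))"
  obtains d q where "m = d + 2" "d \<ge> 2" "q \<ge> 2" "2 * n = 2 + 2 * d * q + d * (d - 1)"
proof -
  define d where "d = m - 2"
  have md: "m = d + 2" "d \<ge> 2"
    using m by (auto simp: d_def)
  define b where "b = 1 + d * (d - 1) div 2"
  have b2: "2 * b = 2 + d * (d - 1)"
    using even_mult_iff[of d "d - 1"] md(2) by (simp add: b_def)
  \<comment> \<open>Thus \<open>m * (m - 1) div 2\<close> is \<open>b + 2 * d\<close>, which is what
    forces \<open>q \<ge> 2\<close>.\<close>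
  have "m * (m - 1) = 2 * b + 4 * d"
    using md(2) unfolding b2 md(1) by (cases d) (auto simp: algebra_simps)
  with n have nb: "b + 2 * d \<le> n"
    by simp
  have "[n = b] (mod d)"
  proof (cases "odd d")
    case True
    then obtain k where "d = 2 * k + 1"
      by (rule oddE)
    then have "b = 1 + k * d"
      by (simp add: b_def)
    then have "[b = 1] (mod d)"
      by (simp only: cong_def mod_mult_self1)
    moreover have "[n = 1] (mod d)"
      using cong True md(1) by simp
    ultimately show ?thesis
      using cong_sym cong_trans by blast
  next
    case False
    then obtain k where k: "d = 2 * Suc k"
      using md(2) by (metis evenE not0_implies_Suc mult_0_right not_numeral_le_zero)
    then have "b = m div 2 + k * d"
      by (simp add: b_def md(1) algebra_simps)
    then have "[b = m div 2] (mod d)"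
      by (simp only: cong_def mod_mult_self1)
    moreover have "[n = m div 2] (mod d)"
      using cong False md(1) by simp
    ultimately show ?thesis
      using cong_sym cong_trans by blast
  qed
  then have "d dvd n - b"
    using nb cong_altdef_nat by (metis add_leD1)
  then obtain q where q: "n - b = d * q"
    by (rule dvdE)
  with nb have "2 * d \<le> d * q" "n = b + d * q"
    by linarith+
  with md(2) b2 have "q \<ge> 2" "2 * n = 2 + 2 * d * q + d * (d - 1)"
    by simp_all
  with md that show thesis by blast
qed

theorem theorem4:
  fixes m n :: nat
  assumes "m \<ge> 4"
    and "n \<ge> m * (m - 1) div 2"
    and "(odd m \<and> [n = 1] (mod (m - 2))) \<or> (even m \<and> [n = m div 2] (mod (m - 2)))"
  shows "\<exists>r::nat. r > 0 \<and> of_nat r = c n m \<and>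
    (\<forall>\<chi> :: nat \<Rightarrow> nat. exact_coloring r {1..n} \<chi> \<longrightarrow>
      (\<exists>x. solution m n x \<and> rainbow \<chi> m x))"
proof -
  obtain d q where dq: "m = d + 2" "d \<ge> 2" "q \<ge> 2" "2 * n = 2 + 2 * d * q + d * (d - 1)"
    by (rule parameter_decomposition[OF assms])
  \<comment> \<open>Ensures that the truncated \<open>n - q\<close> agrees with the rational
    difference.\<close>
  have "2 * q \<le> d * q"
    using dq(2) by simp
  with dq(4) have "q \<le> n"
    by linarith
  have "2 * (of_nat n :: rat) = of_nat (2 + 2 * d * q + d * (d - 1))"
    by (metis dq(4) of_nat_mult of_nat_numeral)
  then have n: "(of_nat n :: rat) = 1 + of_nat d * of_nat q + of_nat d * (of_nat d - 1) / 2"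
    using dq(2) by (simp add: of_nat_diff)
  have "of_nat (n - q + 2) = c n m"
    using dq(2) \<open>q \<le> n\<close> unfolding c_def dq(1)
    by (simp add: of_nat_diff n field_simps)
  moreover have "\<forall>\<chi>. exact_coloring (n - q + 2) {1..n} \<chi> \<longrightarrow>
      (\<exists>x. solution m n x \<and> rainbow \<chi> m x)"
    using rainbow_solution_exists[OF dq(2-4)] unfolding dq(1) by blast
  ultimately show ?thesis
    by (intro exI[of _ "n - q + 2"]) simp
qed

end
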